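(* Let $R>0$, let $m\in\{1,2\}$, and let $f,\rho:[0,R]\to[0,\infty)$ be functions of class $C^m([0,R])$. Set $C_1=1/2$ and $C_2=1/24$. For an integer $N\ge1$ put $\Delta\varepsilon=R/N$, and let the grid points be - $\varepsilon_i=(i-1)\Delta\varepsilon$, $i=1,\dots,N$ (rectangular rule), if $m=1$; - $\varepsilon_i=(i-1/2)\Delta\varepsilon$, $i=1,\dots,N$ (midpoint rule), if $m=2$. Then there is a constant $M_m$, depending on $f$ and $\rho$ and their derivatives up to the order $m$ (and not on $N$ or $i$), such that for every $N\ge1$ and every $i\in\{1,\dots,N\}$ $$\bigl|Q_R(f)(\varepsilon_i)-\tilde Q_R(f)(\varepsilon_i)\bigr|\le R^2\,C_m\,(\Delta\varepsilon)^m\,M_m ,$$ where $Q_R(f)$ is the truncated boson collision integral and $\tilde Q_R(f)$ is its quadrature approximation on the grid, both defined in the context.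
   Context: Truncated collision operator: for $\varepsilon\in[0,R]$, $$Q_R(f)(\varepsilon)=\int_{[0,R]^3}\delta(\varepsilon+\varepsilon_*-\varepsilon'-\varepsilon_*')\,\rho(\varepsilon_{\min})\,[f'f_*'(1+f)(1+f_* )-ff_*(1+f')(1+f_*')]\,d\varepsilon_*\,d\varepsilon'\,d\varepsilon_*',$$ where $f=f(\varepsilon)$, $f_*=f(\varepsilon_* )$, $f'=f(\varepsilon')$, $f_*'=f(\varepsilon_*')$ and $\varepsilon_{\min}=\min\{\varepsilon,\varepsilon_*,\varepsilon',\varepsilon_*'\}$. Carrying out the integration of the delta function, this means $$Q_R(f)(\varepsilon)=\int_0^R\int_{S(\varepsilon,\varepsilon')}^{D(\varepsilon,\varepsilon')}\rho(\varepsilon_{\min})\,F(\varepsilon,\varepsilon',\varepsilon_*')\,d\varepsilon_*'\,d\varepsilon',$$ with $\varepsilon_*=\varepsilon'+\varepsilon_*'-\varepsilon$, $S(\varepsilon,\varepsilon')=\max\{\varepsilon-\varepsilon',0\}$, $D(\varepsilon,\varepsilon')=\min\{\varepsilon-\varepsilon'+R,R\}$ and $F(\varepsilon,\varepsilon',\varepsilon_*')=f'f_*'(1+f)(1+f_* )-ff_*(1+f')(1+f_*')$. Quadrature formula: with $w=R/N=\Delta\varepsilon$ and $f_i=f(\varepsilon_i)$, $$\tilde Q_R(f)(\varepsilon_i)=w^2\sum_{\substack{j,l=1\\ 1\le k=i+j-l\le N}}^N\rho(\min\{\varepsilon_i,\varepsilon_j,\varepsilon_k,\varepsilon_l\})\,[f_kf_l(1+f_i)(1+f_j)-f_if_j(1+f_k)(1+f_l)],$$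 the sum being over all $j,l\in\{1,\dots,N\}$ for which $k:=i+j-l$ lies in $\{1,\dots,N\}$. *)

theory Defs
  imports "HOL-Analysis.Analysis"
begin

(* Class C^m on a set S (used for S = [0,R]): g k is the k-th derivative. Derivatives are taken
   within S, hence one-sided at the endpoints of an interval; values of f outside S are irrelevant. *)
definition Ck_on :: "nat \<Rightarrow> real set \<Rightarrow> (real \<Rightarrow> real) \<Rightarrow> bool" where
  "Ck_on m S f \<longleftrightarrow>
     (\<exists>g :: nat \<Rightarrow> real \<Rightarrow> real.
        (\<forall>x\<in>S. g 0 x = f x) \<and>
        (\<forall>k<m. \<forall>x\<in>S. (g k has_real_derivative g (Suc k) x) (at x within S)) \<and>
        (\<forall>k\<le>m. continuous_on S (g k)))"

(* Arguments in the order \<epsilon>, \<epsilon>\<^sub>*, \<epsilon>', \<epsilon>\<^sub>*'. *)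
definition boson_integrand ::
    "(real \<Rightarrow> real) \<Rightarrow> (real \<Rightarrow> real) \<Rightarrow> real \<Rightarrow> real \<Rightarrow> real \<Rightarrow> real \<Rightarrow> real" where
  "boson_integrand \<rho> f e es e' es' =
     \<rho> (Min {e, es, e', es'}) *
       (f e' * f es' * (1 + f e) * (1 + f es) - f e * f es * (1 + f e') * (1 + f es'))"

(* The truncated collision operator after integrating out the delta function, which fixes
   \<epsilon>\<^sub>* = \<epsilon>' + \<epsilon>\<^sub>*' - \<epsilon>; the bounds of the inner integral express 0 \<le> \<epsilon>\<^sub>* \<le> R and 0 \<le> \<epsilon>\<^sub>*' \<le> R. *)
definition Q_trunc :: "real \<Rightarrow> (real \<Rightarrow> real) \<Rightarrow> (real \<Rightarrow> real) \<Rightarrow> real \<Rightarrow> real" where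
  "Q_trunc R \<rho> f e =
     integral {0..R} (\<lambda>e'.
       integral {max (e - e') 0 .. min (e - e' + R) R} (\<lambda>es'.
         boson_integrand \<rho> f e (e' + es' - e) e' es'))"

(* Quadrature at the i-th of the grid points x 1, ..., x N. The subtraction i + j - l on naturals
   truncates to 0 when i + j < l, and the condition 1 \<le> i + j - l then excludes the pair (j, l). *)
definition Q_quad ::
    "real \<Rightarrow> nat \<Rightarrow> (nat \<Rightarrow> real) \<Rightarrow> (real \<Rightarrow> real) \<Rightarrow> (real \<Rightarrow> real) \<Rightarrow> nat \<Rightarrow> real" where
  "Q_quad R N x \<rho> f i =
     (R / real N)\<^sup>2 *
       (\<Sum>(j, l) \<in> {(j, l). j \<in> {1..N} \<and> l \<in> {1..N} \<and> 1 \<le> i + j - l \<and> i + j - l \<le> N}.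
          boson_integrand \<rho> f (x i) (x j) (x (i + j - l)) (x l))"

(* m = 1: rectangular rule; m = 2: midpoint rule. Other values of m are not used. *)
definition grid :: "nat \<Rightarrow> real \<Rightarrow> nat \<Rightarrow> nat \<Rightarrow> real" where
  "grid m R N i = (if m = 1 then (real i - 1) * (R / real N) else (real i - 1/2) * (R / real N))"

definition quad_const :: "nat \<Rightarrow> real" where
  "quad_const m = (if m = 1 then 1/2 else 1/24)"

end

theory Submission
  imports Defs
begin

text \<open>
  Integrating the delta function out turns the collision operator at an energy \<open>e\<close> into a double
  integral over the energies \<open>x = \<epsilon>'\<close> and \<open>y = \<epsilon>\<^sub>*'\<close>, on the region where \<open>x\<close>, \<open>y\<close> and \<open>x + y - e\<close> lie in
  \<open>{0..R}\<close>. The slanted edges of this region cut through the square cells of the grid, so a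
  cell-by-cell comparison in the plane would need cancellations along these edges. Iterated
  integration avoids them: if \<open>e\<close> and \<open>x\<close> are grid points, the ends \<open>max (e - x) 0\<close> and
  \<open>min (e - x + R) R\<close> of the inner interval are multiples of the mesh width \<open>w\<close>. The quadrature sum
  is therefore exactly the one-dimensional composite rule for the inner integral, followed by the
  one-dimensional composite rule for the outer one (\<open>iterated_rule_error\<close>), and it suffices to
  bound the error of a single cell for each.

  Two observations make the midpoint rule second order for the integrand \<open>G x y\<close> and its inner
  integral \<open>H x\<close>, although neither needs to be twice differentiable. First, the smallest of the four energies is
  \<open>min x e + min y e - e\<close>, so that \<open>\<rho>(\<epsilon>\<^sub>m\<^sub>i\<^sub>n)\<close> loses smoothness only on the lines \<open>x = e\<close> and
  \<open>y = e\<close>; gain and loss balance there, and the vanishing factor keeps \<open>G\<close> differentiable across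
  the lines. Second, the ends of the inner interval have their kinks at \<open>x = e\<close> as well, where
  again \<open>G = 0\<close>. Since \<open>e\<close> is itself a cell midpoint, a kink lies either at the midpoint of a cell
  or outside the interior of the cell.

  No derivative of \<open>G\<close> or \<open>H\<close> is formed. The error of the midpoint rule on one cell is controlled by
  the symmetric second differences \<open>h (c + t) + h (c - t) - 2 * h c\<close> at its midpoint
  (\<open>midpoint_rule_error\<close>), and bounds of the form \<open>K * t\<^sup>2\<close> for them pass through products
  (\<open>second_close_mult\<close>) and through integrals with moving ends
  (\<open>section_integral_second_difference\<close>). Likewise Lipschitz bounds suffice for the
  rectangular rule (\<open>left_endpoint_rule_error\<close>).

  To evaluate \<open>G\<close> also where \<open>x + y - e\<close> leaves \<open>{0..R}\<close>, the functions \<open>f\<close> and \<open>\<rho>\<close> are first extended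
  to \<open>{-R..2 * R}\<close>, keeping the bounds on first and, if \<open>m = 2\<close>, on second differences
  (\<open>Ck_on_extension\<close>).
\<close>

section \<open>Increments of functions with bounded or Lipschitz derivatives\<close>

lemma mean_value_within:
  fixes g g' :: "real \<Rightarrow> real"
  assumes der: "\<And>x. x \<in> {a..b} \<Longrightarrow> (g has_real_derivative g' x) (at x within {a..b})"
    and "a \<le> u" "u \<le> v" "v \<le> b"
  obtains z where "z \<in> {u..v}" "g v - g u = g' z * (v - u)"
proof (cases "u = v")
  case True
  then show ?thesis using that[of u] by simp
next
  case False
  have "(g has_derivative (\<lambda>h. g' x * h)) (at x within {u..v})" if "u \<le> x" "x \<le> v" for x
    using der[of x] that assms(2-4)
    by (auto simp: has_field_derivative_def intro: has_derivative_subset)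
  then have "\<exists>z\<in>{u<..<v}. g v - g u = g' z * (v - u)"
    using False assms(3) by (intro mvt_simple) auto
  then show ?thesis using that by (meson atLeastAtMost_iff greaterThanLessThan_iff less_imp_le)
qed

lemma bounded_derivative_imp_lipschitz:
  fixes g g' :: "real \<Rightarrow> real"
  assumes der: "\<And>x. x \<in> {a..b} \<Longrightarrow> (g has_real_derivative g' x) (at x within {a..b})"
    and bd: "\<And>x. x \<in> {a..b} \<Longrightarrow> \<bar>g' x\<bar> \<le> L"
    and "x \<in> {a..b}" "y \<in> {a..b}"
  shows "\<bar>g x - g y\<bar> \<le> L * \<bar>x - y\<bar>"
  using assms(3,4)
proof (induction x y rule: linorder_wlog)
  case (le x y)
  obtain z where z: "z \<in> {x..y}" "g y - g x = g' z * (y - x)"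
    using mean_value_within[of a b g g' x y] der le by auto
  have "\<bar>g y - g x\<bar> = \<bar>g' z\<bar> * \<bar>y - x\<bar>" unfolding z by (simp add: abs_mult)
  also have "\<dots> \<le> L * \<bar>y - x\<bar>" using bd[of z] z le by (intro mult_right_mono) auto
  finally show ?case by (simp add: abs_minus_commute)
next
  case (sym x y)
  then show ?case by (simp add: abs_minus_commute)
qed

lemma lipschitz_derivative_imp_second_difference:
  fixes g g' :: "real \<Rightarrow> real"
  assumes der: "\<And>x. x \<in> {a..b} \<Longrightarrow> (g has_real_derivative g' x) (at x within {a..b})"
    and lip: "\<And>x y. x \<in> {a..b} \<Longrightarrow> y \<in> {a..b} \<Longrightarrow> \<bar>g' x - g' y\<bar> \<le> L * \<bar>x - y\<bar>"
    and t: "0 \<le> t" "a \<le> c - t" "c + t \<le> b" and "0 \<le> L"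
  shows "\<bar>g (c + t) + g (c - t) - 2 * g c\<bar> \<le> 2 * L * t\<^sup>2"
proof -
  obtain p where p: "p \<in> {c..c + t}" "g (c + t) - g c = g' p * t"
    using mean_value_within[of a b g g' c "c + t"] der t by auto
  obtain q where q: "q \<in> {c - t..c}" "g c - g (c - t) = g' q * t"
    using mean_value_within[of a b g g' "c - t" c] der t by auto
  have "\<bar>g' p - g' q\<bar> \<le> L * \<bar>p - q\<bar>" using lip[of p q] p q t by auto
  also have "\<dots> \<le> L * (2 * t)" using p q \<open>0 \<le> L\<close> by (intro mult_left_mono) auto
  finally have "\<bar>g' p - g' q\<bar> * t \<le> L * (2 * t) * t" using t by (intro mult_right_mono) auto
  moreover have "g (c + t) + g (c - t) - 2 * g c = (g' p - g' q) * t"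
    using p(2) q(2) by (simp add: algebra_simps)
  ultimately show ?thesis using t by (simp add: abs_mult power2_eq_square mult_ac)
qed

text \<open>
  The extension is an antiderivative of \<open>f'\<close> continued by its boundary values, so that no gluing of
  derivatives at the end points is needed; on \<open>{0..R}\<close> it differs from \<open>f\<close> by a constant.
\<close>
lemma C1_extension:
  fixes f f' :: "real \<Rightarrow> real"
  assumes "0 < R"
    and der: "\<And>x. x \<in> {0..R} \<Longrightarrow> (f has_real_derivative f' x) (at x within {0..R})"
    and cont: "continuous_on {0..R} f'"
  obtains g where "\<And>x. x \<in> {0..R} \<Longrightarrow> g x = f x"
    and "\<And>x. x \<in> {-R..2 * R} \<Longrightarrow>
           (g has_real_derivative f' (max 0 (min R x))) (at x within {-R..2 * R})"
proof -
  have "continuous_on {-R..2 * R} (\<lambda>x. f' (max 0 (min R x)))"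
    using \<open>0 < R\<close> by (intro continuous_on_compose2[OF cont] continuous_intros) auto
  then obtain h where "\<And>x. x \<in> {-R..2 * R} \<Longrightarrow>
      (h has_vector_derivative f' (max 0 (min R x))) (at x within {-R..2 * R})"
    using antiderivative_continuous by metis
  then have h: "(h has_real_derivative f' (max 0 (min R x))) (at x within {-R..2 * R})"
    if "x \<in> {-R..2 * R}" for x
    using that by (simp add: has_real_derivative_iff_has_vector_derivative)
  have "((\<lambda>x. f x - h x) has_field_derivative 0) (at x within {0..R})" if "x \<in> {0..R}" for x
  proof -
    have "(h has_real_derivative f' (max 0 (min R x))) (at x within {0..R})"
      using that \<open>0 < R\<close> by (intro DERIV_subset[OF h]) auto
    moreover have "max 0 (min R x) = x" using that by auto
    ultimately show ?thesis using DERIV_diff[OF der[OF that], of h "f' x"] by simp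
  qed
  then obtain k where k: "\<forall>x\<in>{0..R}. f x - h x = k"
    using has_field_derivative_zero_constant[of "{0..R}" "\<lambda>x. f x - h x"] by auto
  show ?thesis
  proof
    show "h x + k = f x" if "x \<in> {0..R}" for x using k that by force
    show "((\<lambda>x. h x + k) has_real_derivative f' (max 0 (min R x))) (at x within {-R..2 * R})"
      if "x \<in> {-R..2 * R}" for x
      using DERIV_add[OF h[OF that] DERIV_const[of k]] by simp
  qed
qed

section \<open>Bounds on first and second differences\<close>

text \<open>
  Only finitely many values of a function enter an estimate at a time, so boundedness and Lipschitz
  continuity are expressed for two values \<open>u\<close>, \<open>v\<close> taken at distance \<open>d\<close>. A single constant \<open>B\<close> for
  both properties makes the predicate stable under sums and products, and these closure lemmas give
  a constant for a compound expression that depends only on the constants of its parts.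
\<close>

definition close :: "real \<Rightarrow> real \<Rightarrow> real \<Rightarrow> real \<Rightarrow> bool" where
  "close B d u v \<longleftrightarrow> \<bar>u\<bar> \<le> B \<and> \<bar>v\<bar> \<le> B \<and> \<bar>u - v\<bar> \<le> B * d"

text \<open>
  The arguments \<open>u\<close>, \<open>v\<close>, \<open>w\<close> stand for values of a function at \<open>c + t\<close>, \<open>c\<close>, \<open>c - t\<close>.
\<close>
definition second_close :: "real \<Rightarrow> real \<Rightarrow> real \<Rightarrow> real \<Rightarrow> real \<Rightarrow> bool" where
  "second_close B t u v w \<longleftrightarrow> close B t u v \<and> close B t w v \<and> \<bar>u + w - 2 * v\<bar> \<le> B * t\<^sup>2"

lemma close_nonneg:
  assumes "close B d u v"
  shows "0 \<le> B" "0 \<le> B * d"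
  using assms abs_ge_zero order_trans unfolding close_def by blast+

lemma abs_mult_le: "\<bar>a\<bar> \<le> A \<Longrightarrow> \<bar>b\<bar> \<le> B \<Longrightarrow> \<bar>a * b\<bar> \<le> A * B" for a b :: real
  by (simp add: abs_mult mult_mono')

lemma close_const: "0 \<le> d \<Longrightarrow> \<bar>u\<bar> \<le> B \<Longrightarrow> close B d u u"
  unfolding close_def by auto

lemma close_mono:
  assumes "close B d u v" "d \<le> d'"
  shows "close B d' u v"
  using assms mult_left_mono[OF assms(2) close_nonneg(1)[OF assms(1)]] unfolding close_def by linarith

lemma close_add: "close A d u v \<Longrightarrow> close B d u' v' \<Longrightarrow> close (A + B) d (u + u') (v + v')"
  unfolding close_def distrib_right by linarith

lemma close_diff: "close A d u v \<Longrightarrow> close B d u' v' \<Longrightarrow> close (A + B) d (u - u') (v - v')"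
  unfolding close_def distrib_right by linarith

lemma close_mult:
  assumes "close A d u v" "close B d u' v'"
  shows "close (2 * A * B) d (u * u') (v * v')"
proof -
  have bounds: "\<bar>u\<bar> \<le> A" "\<bar>v\<bar> \<le> A" "\<bar>u - v\<bar> \<le> A * d" "\<bar>u'\<bar> \<le> B" "\<bar>v'\<bar> \<le> B" "\<bar>u' - v'\<bar> \<le> B * d"
    using assms unfolding close_def by auto
  have "\<bar>u * u'\<bar> \<le> A * B" "\<bar>v * v'\<bar> \<le> A * B"
    "\<bar>u * (u' - v')\<bar> \<le> A * (B * d)" "\<bar>(u - v) * v'\<bar> \<le> (A * d) * B"
    by (intro abs_mult_le bounds)+
  moreover have "u * u' - v * v' = u * (u' - v') + (u - v) * v'"
    by (simp add: algebra_simps)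
  moreover have "0 \<le> A * B"
    using assms[THEN close_nonneg(1)] by simp
  ultimately show ?thesis unfolding close_def by (auto simp: mult_ac)
qed

lemma second_close_const: "0 \<le> t \<Longrightarrow> \<bar>u\<bar> \<le> B \<Longrightarrow> second_close B t u u u"
  unfolding second_close_def by (auto simp: close_def)

lemma second_close_add:
  "second_close A t u v w \<Longrightarrow> second_close B t u' v' w' \<Longrightarrow>
   second_close (A + B) t (u + u') (v + v') (w + w')"
  unfolding second_close_def by (auto simp: close_add distrib_right)

lemma second_close_diff:
  "second_close A t u v w \<Longrightarrow> second_close B t u' v' w' \<Longrightarrow>
   second_close (A + B) t (u - u') (v - v') (w - w')"
  unfolding second_close_def by (auto simp: close_diff distrib_right)

text \<open>
  The second difference of a product is the sum of each middle value times the second difference of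
  the other factor and of two products of first differences; all four terms are quadratic in \<open>t\<close>.
\<close>
lemma second_close_mult:
  assumes "second_close A t u v w" "second_close B t u' v' w'"
  shows "second_close (4 * A * B) t (u * u') (v * v') (w * w')"
proof -
  have c: "close A t u v" "close A t w v" "close B t u' v'" "close B t w' v'"
    and s: "\<bar>u + w - 2 * v\<bar> \<le> A * t\<^sup>2" "\<bar>u' + w' - 2 * v'\<bar> \<le> B * t\<^sup>2"
    using assms unfolding second_close_def by auto
  have d: "\<bar>v\<bar> \<le> A" "\<bar>u - v\<bar> \<le> A * t" "\<bar>w - v\<bar> \<le> A * t"
    "\<bar>v'\<bar> \<le> B" "\<bar>u' - v'\<bar> \<le> B * t" "\<bar>w' - v'\<bar> \<le> B * t"
    using c unfolding close_def by auto
  have weaken: "close (4 * A * B) t p q" if "close (2 * A * B) t p q" for p q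
    using that close_nonneg[OF that] unfolding close_def by auto
  have "\<bar>v * (u' + w' - 2 * v')\<bar> \<le> A * (B * t\<^sup>2)" "\<bar>v' * (u + w - 2 * v)\<bar> \<le> B * (A * t\<^sup>2)"
    "\<bar>(u - v) * (u' - v')\<bar> \<le> (A * t) * (B * t)" "\<bar>(w - v) * (w' - v')\<bar> \<le> (A * t) * (B * t)"
    by (intro abs_mult_le d s)+
  moreover have "u * u' + w * w' - 2 * (v * v') = v * (u' + w' - 2 * v') + v' * (u + w - 2 * v)
      + (u - v) * (u' - v') + (w - v) * (w' - v')"
    by (simp add: algebra_simps)
  ultimately have "\<bar>u * u' + w * w' - 2 * (v * v')\<bar> \<le> 4 * A * B * t\<^sup>2"
    by (simp add: power2_eq_square mult_ac)
  moreover have "close (4 * A * B) t (u * u') (v * v')" "close (4 * A * B) t (w * w') (v * v')"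
    by (intro weaken close_mult c)+
  ultimately show ?thesis unfolding second_close_def by blast
qed

text \<open>
  A factor that vanishes in the middle has outer values of order \<open>t\<close>, so the other factor needs only
  a Lipschitz bound. This is what absorbs the kink of \<open>\<rho>(\<epsilon>\<^sub>m\<^sub>i\<^sub>n)\<close>.
\<close>
lemma second_close_mult_vanishing:
  assumes "close A t u v" "close A t w v" "second_close B t u' 0 w'"
  shows "\<bar>u * u' + w * w'\<bar> \<le> 3 * A * B * t\<^sup>2"
proof -
  have d: "\<bar>v\<bar> \<le> A" "\<bar>u - v\<bar> \<le> A * t" "\<bar>w - v\<bar> \<le> A * t"
    "\<bar>u' + w'\<bar> \<le> B * t\<^sup>2" "\<bar>u'\<bar> \<le> B * t" "\<bar>w'\<bar> \<le> B * t"
    using assms unfolding second_close_def close_def by auto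
  have "\<bar>v * (u' + w')\<bar> \<le> A * (B * t\<^sup>2)"
    "\<bar>(u - v) * u'\<bar> \<le> (A * t) * (B * t)" "\<bar>(w - v) * w'\<bar> \<le> (A * t) * (B * t)"
    by (intro abs_mult_le d)+
  moreover have "u * u' + w * w' = v * (u' + w') + (u - v) * u' + (w - v) * w'"
    by (simp add: algebra_simps)
  ultimately show ?thesis by (simp add: power2_eq_square mult_ac)
qed

section \<open>Extension of the density and the collision weight\<close>

text \<open>
  The interval \<open>{-R..2 * R}\<close> contains \<open>x + y - e\<close> for all energies in \<open>{0..R}\<close>.
\<close>
lemma Ck_on_extension:
  assumes "0 < R" "1 \<le> m" "Ck_on m {0..R} f"
  obtains g B where "\<And>x. x \<in> {0..R} \<Longrightarrow> g x = f x"
    and "\<And>x y. x \<in> {-R..2 * R} \<Longrightarrow> y \<in> {-R..2 * R} \<Longrightarrow> close B \<bar>x - y\<bar> (g x) (g y)"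
    and "\<And>c t. 2 \<le> m \<Longrightarrow> 0 \<le> t \<Longrightarrow> c - t \<in> {-R..2 * R} \<Longrightarrow> c + t \<in> {-R..2 * R} \<Longrightarrow>
           second_close B t (g (c + t)) (g c) (g (c - t))"
proof -
  obtain d where d0: "\<And>x. x \<in> {0..R} \<Longrightarrow> d 0 x = f x"
    and der: "\<And>k x. k < m \<Longrightarrow> x \<in> {0..R} \<Longrightarrow>
           (d k has_real_derivative d (Suc k) x) (at x within {0..R})"
    and cont: "\<And>k. k \<le> m \<Longrightarrow> continuous_on {0..R} (d k)"
    using assms(3) unfolding Ck_on_def by blast
  obtain g where g: "\<And>x. x \<in> {0..R} \<Longrightarrow> g x = d 0 x"
    and gder: "\<And>x. x \<in> {-R..2 * R} \<Longrightarrow>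
           (g has_real_derivative d 1 (max 0 (min R x))) (at x within {-R..2 * R})"
    using C1_extension[of R "d 0" "d 1"] der[of 0] cont[of 1] assms(1,2) by auto
  have bounded: "\<exists>L\<ge>0. \<forall>x\<in>{a..b}. \<bar>h x\<bar> \<le> L" if "continuous_on {a..b} h" for a b and h :: "real \<Rightarrow> real"
  proof -
    have "bounded (h ` {a..b})" using that by (intro compact_imp_bounded compact_continuous_image) auto
    then show ?thesis unfolding bounded_pos by (auto intro: less_imp_le)
  qed
  obtain L1 where L1: "0 \<le> L1" "\<And>x. x \<in> {0..R} \<Longrightarrow> \<bar>d 1 x\<bar> \<le> L1"
    using bounded[OF cont[of 1]] assms(2) by auto
  have "continuous_on {-R..2 * R} g"
    using gder by (meson DERIV_continuous continuous_on_eq_continuous_within)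
  then obtain L0 where L0: "0 \<le> L0" "\<And>x. x \<in> {-R..2 * R} \<Longrightarrow> \<bar>g x\<bar> \<le> L0"
    using bounded by metis
  have lip: "\<bar>g x - g y\<bar> \<le> L1 * \<bar>x - y\<bar>" if "x \<in> {-R..2 * R}" "y \<in> {-R..2 * R}" for x y
    using that L1 assms(1) by (intro bounded_derivative_imp_lipschitz[OF gder]) auto
  have "\<exists>L2\<ge>0. 2 \<le> m \<longrightarrow> (\<forall>x\<in>{0..R}. \<bar>d 2 x\<bar> \<le> L2)"
    using bounded[OF cont[of 2]] by (cases "2 \<le> m") auto
  then obtain L2 where L2: "0 \<le> L2" "\<And>x. 2 \<le> m \<Longrightarrow> x \<in> {0..R} \<Longrightarrow> \<bar>d 2 x\<bar> \<le> L2"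
    by blast
  have second: "\<bar>g (c + t) + g (c - t) - 2 * g c\<bar> \<le> 2 * L2 * t\<^sup>2"
    if "2 \<le> m" "0 \<le> t" "c - t \<in> {-R..2 * R}" "c + t \<in> {-R..2 * R}" for c t
  proof (rule lipschitz_derivative_imp_second_difference[OF gder])
    fix x y :: real assume "x \<in> {-R..2 * R}" "y \<in> {-R..2 * R}"
    have "\<bar>d 1 (max 0 (min R x)) - d 1 (max 0 (min R y))\<bar>
        \<le> L2 * \<bar>max 0 (min R x) - max 0 (min R y)\<bar>"
      using der[of 1] that L2 assms(1)
      by (intro bounded_derivative_imp_lipschitz[of 0 R "d 1" "d 2"]) (auto simp: numeral_2_eq_2)
    also have "\<dots> \<le> L2 * \<bar>x - y\<bar>" using L2(1) by (intro mult_left_mono) auto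
    finally show "\<bar>d 1 (max 0 (min R x)) - d 1 (max 0 (min R y))\<bar> \<le> L2 * \<bar>x - y\<bar>" .
  qed (use that L2 in auto)
  define B where "B = L0 + L1 + 2 * L2"
  have close: "close B \<bar>x - y\<bar> (g x) (g y)" if "x \<in> {-R..2 * R}" "y \<in> {-R..2 * R}" for x y
  proof -
    have "L1 * \<bar>x - y\<bar> \<le> B * \<bar>x - y\<bar>"
      unfolding B_def using L0(1) L2(1) by (intro mult_right_mono) auto
    then show ?thesis
      using lip[OF that] L0(2)[OF that(1)] L0(2)[OF that(2)] L1(1) L2(1)
      unfolding close_def B_def by auto
  qed
  show ?thesis
  proof
    show "g x = f x" if "x \<in> {0..R}" for x using that g d0 by simp
    show "close B \<bar>x - y\<bar> (g x) (g y)" if "x \<in> {-R..2 * R}" "y \<in> {-R..2 * R}" for x y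
      by (rule close[OF that])
    show "second_close B t (g (c + t)) (g c) (g (c - t))"
      if a: "2 \<le> m" "0 \<le> t" "c - t \<in> {-R..2 * R}" "c + t \<in> {-R..2 * R}" for c t
    proof -
      have "2 * L2 * t\<^sup>2 \<le> B * t\<^sup>2"
        unfolding B_def using L0(1) L1(1) by (intro mult_right_mono) auto
      then show ?thesis
        using second[OF a] close[of "c + t" c] close[of "c - t" c] a
        unfolding second_close_def by auto
    qed
  qed
qed

section \<open>One-dimensional quadrature rules\<close>

lemma left_endpoint_rule_error:
  fixes h :: "real \<Rightarrow> real"
  assumes "0 \<le> w" and cont: "continuous_on {c..c + w} h"
    and lip: "\<And>x. x \<in> {c..c + w} \<Longrightarrow> \<bar>h x - h c\<bar> \<le> L * (x - c)"
  shows "\<bar>integral {c..c + w} h - w * h c\<bar> \<le> 1 / 2 * w ^ 2 * L"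
proof -
  have "((\<lambda>x. L * (x - c)) has_integral (L * (c + w - c)\<^sup>2 / 2 - L * (c - c)\<^sup>2 / 2)) {c..c + w}"
    using \<open>0 \<le> w\<close>
    by (intro fundamental_theorem_of_calculus)
       (auto simp: has_real_derivative_iff_has_vector_derivative[symmetric]
             intro!: derivative_eq_intros)
  then have bound: "((\<lambda>x. L * (x - c)) has_integral 1 / 2 * w ^ 2 * L) {c..c + w}"
    by (simp add: mult_ac)
  have "((\<lambda>x. h x - h c) has_integral integral {c..c + w} h - w * h c) {c..c + w}"
    using has_integral_diff[OF integrable_integral[OF integrable_continuous_real[OF cont]]
        has_integral_const_real[of "h c" c "c + w"]] \<open>0 \<le> w\<close> by simp
  with bound show ?thesis
    using integral_norm_bound_integral[of "\<lambda>x. h x - h c" "{c..c + w}" "\<lambda>x. L * (x - c)"] lip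
    by (simp only: has_integral_iff real_norm_def)
qed

text \<open>
  Folding the cell at its midpoint writes the error as the integral of the symmetric second
  difference over \<open>{0..w / 2}\<close>, which is at most \<open>K * (w / 2)^3 / 3\<close>. The bound concerns symmetric
  pairs only, so a kink at the midpoint is harmless as long as it is compatible with the bound.
\<close>
lemma midpoint_rule_error:
  fixes h :: "real \<Rightarrow> real"
  assumes "0 \<le> w" and cont: "continuous_on {c - w / 2..c + w / 2} h"
    and second: "\<And>t. t \<in> {0..w / 2} \<Longrightarrow> \<bar>h (c + t) + h (c - t) - 2 * h c\<bar> \<le> K * t\<^sup>2"
  shows "\<bar>integral {c - w / 2..c + w / 2} h - w * h c\<bar> \<le> 1 / 24 * w ^ 3 * K"
proof -
  have int: "(h has_integral integral {a..b} h) {a..b}" if "c - w / 2 \<le> a" "b \<le> c + w / 2" for a b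
    using that by (intro integrable_integral integrable_continuous_real continuous_on_subset[OF cont]) auto
  have right: "((\<lambda>t. h (c + t)) has_integral integral {c..c + w / 2} h) {0..w / 2}"
    using has_integral_shift_real_ivl[OF int[of c "c + w / 2"], of c] \<open>0 \<le> w\<close>
    by (simp add: add.commute)
  have "((\<lambda>t. h (t + c)) has_integral integral {c - w / 2..c} h) {- (w / 2)..- 0}"
    using has_integral_shift_real_ivl[OF int[of "c - w / 2" c], of c] \<open>0 \<le> w\<close> by simp
  then have left: "((\<lambda>t. h (c - t)) has_integral integral {c - w / 2..c} h) {0..w / 2}"
    using has_integral_reflect_real[where f = "\<lambda>t. h (c - t)" and a = 0 and b = "w / 2"]
    by (simp del: has_integral_reflect_real minus_zero add: add.commute)
  have "integral {c - w / 2..c} h + integral {c..c + w / 2} h = integral {c - w / 2..c + w / 2} h"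
    using \<open>0 \<le> w\<close> int by (intro Henstock_Kurzweil_Integration.integral_combine) auto
  then have sym: "((\<lambda>t. h (c + t) + h (c - t) - 2 * h c) has_integral
      integral {c - w / 2..c + w / 2} h - w * h c) {0..w / 2}"
    using has_integral_diff[OF has_integral_add[OF right left]
        has_integral_const_real[of "2 * h c" 0 "w / 2"]] \<open>0 \<le> w\<close> by (simp add: algebra_simps)
  have "((\<lambda>t. K * t\<^sup>2) has_integral (K * (w / 2) ^ 3 / 3 - K * 0 ^ 3 / 3)) {0..w / 2}"
    using \<open>0 \<le> w\<close>
    by (intro fundamental_theorem_of_calculus)
       (auto simp: has_real_derivative_iff_has_vector_derivative[symmetric]
             intro!: derivative_eq_intros)
  then have bound: "((\<lambda>t. K * t\<^sup>2) has_integral 1 / 24 * w ^ 3 * K) {0..w / 2}"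
    by (simp add: power_divide mult_ac)
  show ?thesis
    using integral_norm_bound_integral[of "\<lambda>t. h (c + t) + h (c - t) - 2 * h c" "{0..w / 2}" "\<lambda>t. K * t\<^sup>2"]
      second sym bound by (simp only: has_integral_iff real_norm_def)
qed

text \<open>
  The node \<open>p k\<close> belongs to the \<open>k\<close>-th cell \<open>{(k - 1) * w..k * w}\<close>, counted from \<open>1\<close>.
\<close>
lemma composite_rule_error:
  fixes h :: "real \<Rightarrow> real" and a b :: nat
  assumes "0 \<le> w" "a \<le> b" and cont: "continuous_on {real a * w..real b * w} h"
    and cell: "\<And>k. k \<in> {a<..b} \<Longrightarrow> \<bar>integral {real (k - 1) * w..real k * w} h - w * h (p k)\<bar> \<le> E"
  shows "\<bar>integral {real a * w..real b * w} h - w * (\<Sum>k\<in>{a<..b}. h (p k))\<bar> \<le> real (b - a) * E"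
  using assms(2,3,4)
proof (induction b rule: dec_induct)
  case base
  then show ?case by simp
next
  case (step n)
  have le: "real a * w \<le> real n * w" "real n * w \<le> real (Suc n) * w"
    using step.hyps \<open>0 \<le> w\<close> by (auto intro!: mult_right_mono)
  have "integral {real a * w..real n * w} h + integral {real n * w..real (Suc n) * w} h
      = integral {real a * w..real (Suc n) * w} h"
    using le step.prems(1) by (intro Henstock_Kurzweil_Integration.integral_combine integrable_continuous_real)
  moreover have "\<bar>integral {real a * w..real n * w} h - w * (\<Sum>k\<in>{a<..n}. h (p k))\<bar> \<le> real (n - a) * E"
    using le step.prems by (intro step.IH continuous_on_subset[OF step.prems(1)]) auto
  moreover have "\<bar>integral {real n * w..real (Suc n) * w} h - w * h (p (Suc n))\<bar> \<le> E"
    using step.prems(2)[of "Suc n"] step.hyps by auto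
  moreover have "{a<..Suc n} = insert (Suc n) {a<..n}" using step.hyps by auto
  moreover have "real (Suc n - a) * E = real (n - a) * E + E"
    using step.hyps by (simp add: of_nat_diff algebra_simps)
  ultimately show ?case by (simp add: algebra_simps)
qed

section \<open>Iterated quadrature over the region of admissible energies\<close>

text \<open>
  The locale collects what the error analysis uses of the integrand for a fixed energy \<open>e\<close>: it is
  symmetric, bounded and Lipschitz on the whole square, and zero when \<open>x = e\<close>.
\<close>

locale collision_kernel =
  fixes R e B :: real and G :: "real \<Rightarrow> real \<Rightarrow> real"
  assumes e_mem: "e \<in> {0..R}"
    and kernel_sym: "x \<in> {0..R} \<Longrightarrow> y \<in> {0..R} \<Longrightarrow> G x y = G y x"
    and kernel_close: "x \<in> {0..R} \<Longrightarrow> x' \<in> {0..R} \<Longrightarrow> y \<in> {0..R} \<Longrightarrow> close B \<bar>x - x'\<bar> (G x y) (G x' y)"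
    and kernel_vanish: "y \<in> {0..R} \<Longrightarrow> G e y = 0"
begin

definition section_integral :: "real \<Rightarrow> real" where
  "section_integral x = integral {max (e - x) 0..min (e - x + R) R} (G x)"

text \<open>
  Differences of this function give the inner integral, so that the effect of moving \<open>x\<close> and the
  effect of moving the ends of the integration interval can be studied jointly.
\<close>
definition primitive :: "real \<Rightarrow> real \<Rightarrow> real" where
  "primitive x z = integral {0..z} (G x)"

lemma B_nonneg: "0 \<le> B"
  using close_nonneg(1)[OF kernel_close[OF e_mem e_mem e_mem]] .

lemma kernel_lipschitz:
  assumes "x \<in> {0..R}" "x' \<in> {0..R}" "y \<in> {0..R}" "y' \<in> {0..R}"
  shows "\<bar>G x y - G x' y'\<bar> \<le> B * (\<bar>x - x'\<bar> + \<bar>y - y'\<bar>)"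
proof -
  have "\<bar>G x y - G x' y\<bar> \<le> B * \<bar>x - x'\<bar>"
    using kernel_close[of x x' y] assms unfolding close_def by auto
  moreover have "\<bar>G x' y - G x' y'\<bar> \<le> B * \<bar>y - y'\<bar>"
    using kernel_close[of y y' x'] kernel_sym[of x' y] kernel_sym[of x' y'] assms
    unfolding close_def by auto
  ultimately show ?thesis unfolding distrib_left by linarith
qed

lemma kernel_continuous:
  assumes "x \<in> {0..R}" "0 \<le> a" "b \<le> R"
  shows "continuous_on {a..b} (G x)"
proof -
  have "B-lipschitz_on {a..b} (G x)"
    using kernel_lipschitz[of x x] assms B_nonneg
    by (intro lipschitz_onI) (auto simp: dist_real_def)
  then show ?thesis by (rule lipschitz_on_continuous_on)
qed

lemma kernel_integral:
  assumes "x \<in> {0..R}" "0 \<le> a" "b \<le> R"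
  shows "(G x has_integral integral {a..b} (G x)) {a..b}"
  using kernel_continuous[OF assms] by (intro integrable_integral integrable_continuous_real)

lemma primitive_diff:
  assumes "x \<in> {0..R}" "0 \<le> a" "a \<le> b" "b \<le> R"
  shows "integral {a..b} (G x) = primitive x b - primitive x a"
  using Henstock_Kurzweil_Integration.integral_combine[of 0 a b "G x"] assms kernel_integral[of x 0 b]
  unfolding primitive_def by (force simp: has_integral_iff)

lemma section_integral_eq:
  assumes "x \<in> {0..R}"
  shows "section_integral x = primitive x (min (e - x + R) R) - primitive x (max (e - x) 0)"
  unfolding section_integral_def using assms e_mem by (intro primitive_diff) auto

lemma primitive_increment:
  assumes "x \<in> {0..R}" "0 \<le> a" "a \<le> b" "b \<le> R"
    and "\<And>y. y \<in> {a..b} \<Longrightarrow> \<bar>G x y - v\<bar> \<le> M"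
  shows "\<bar>primitive x b - primitive x a - (b - a) * v\<bar> \<le> M * (b - a)"
proof -
  have "((\<lambda>y. G x y - v) has_integral primitive x b - primitive x a - (b - a) * v) {a..b}"
    using has_integral_diff[OF kernel_integral[of x a b] has_integral_const_real[of v a b]] assms
      primitive_diff[of x a b]
    by auto
  moreover have "continuous_on {a..b} (\<lambda>y. G x y - v)"
    using assms by (intro continuous_intros kernel_continuous)
  ultimately show ?thesis
    using integral_bound[of a b "\<lambda>y. G x y - v" M] assms(3,5) by (auto simp: has_integral_iff)
qed

lemma primitive_lipschitz:
  assumes "x \<in> {0..R}" "x' \<in> {0..R}" "z \<in> {0..R}" "z' \<in> {0..R}"
  shows "\<bar>primitive x z - primitive x' z'\<bar> \<le> R * B * \<bar>x - x'\<bar> + B * \<bar>z - z'\<bar>"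
proof -
  have "((\<lambda>y. G x y - G x' y) has_integral primitive x z - primitive x' z) {0..z}"
    unfolding primitive_def using assms by (intro has_integral_diff kernel_integral) auto
  moreover have "norm (integral {0..z} (\<lambda>y. G x y - G x' y)) \<le> (B * \<bar>x - x'\<bar>) * (z - 0)"
    using assms kernel_continuous[of x 0 z] kernel_continuous[of x' 0 z] kernel_close[of x x']
    by (intro integral_bound continuous_intros) (auto simp: close_def)
  ultimately have "\<bar>primitive x z - primitive x' z\<bar> \<le> (B * \<bar>x - x'\<bar>) * z"
    by (simp add: has_integral_iff)
  also have "\<dots> \<le> (B * \<bar>x - x'\<bar>) * R"
    using assms B_nonneg by (intro mult_left_mono) auto
  finally have "\<bar>primitive x z - primitive x' z\<bar> \<le> R * B * \<bar>x - x'\<bar>" by (simp add: mult_ac)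
  moreover have "\<bar>primitive x' z - primitive x' z'\<bar> \<le> B * \<bar>z - z'\<bar>"
    using assms(3,4)
  proof (induction z z' rule: linorder_wlog)
    case (le a b)
    have "\<bar>G x' y\<bar> \<le> B" if "y \<in> {a..b}" for y
      using kernel_close[of x' x' y] assms(2) le that unfolding close_def by auto
    then have "\<bar>primitive x' b - primitive x' a - (b - a) * 0\<bar> \<le> B * (b - a)"
      using assms(2) le by (intro primitive_increment) auto
    then show ?case using le by (auto simp: abs_minus_commute)
  next
    case (sym a b)
    then show ?case by (simp add: abs_minus_commute)
  qed
  ultimately show ?thesis by linarith
qed

text \<open>
  Both ends of the inner interval move with speed at most one.
\<close>
lemma section_integral_lipschitz:
  assumes "x \<in> {0..R}" "x' \<in> {0..R}"
  shows "\<bar>section_integral x - section_integral x'\<bar> \<le> (2 * R * B + 2 * B) * \<bar>x - x'\<bar>"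
proof -
  have move: "\<bar>primitive x z - primitive x' z'\<bar> \<le> (R * B + B) * \<bar>x - x'\<bar>"
    if "z \<in> {0..R}" "z' \<in> {0..R}" "\<bar>z - z'\<bar> \<le> \<bar>x - x'\<bar>" for z z'
    using primitive_lipschitz[OF assms that(1,2)] mult_left_mono[OF that(3) B_nonneg]
    unfolding distrib_right by linarith
  have "\<bar>primitive x (min (e - x + R) R) - primitive x' (min (e - x' + R) R)\<bar> \<le> (R * B + B) * \<bar>x - x'\<bar>"
    "\<bar>primitive x (max (e - x) 0) - primitive x' (max (e - x') 0)\<bar> \<le> (R * B + B) * \<bar>x - x'\<bar>"
    using assms e_mem by (auto intro!: move)
  moreover have "\<bar>(u - v) - (u' - v')\<bar> \<le> (2 * R * B + 2 * B) * d"
    if "\<bar>u - u'\<bar> \<le> (R * B + B) * d" "\<bar>v - v'\<bar> \<le> (R * B + B) * d" for u v u' v' d :: real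
    using that unfolding distrib_right by linarith
  ultimately show ?thesis
    unfolding section_integral_eq[OF assms(1)] section_integral_eq[OF assms(2)] by blast
qed

lemma section_integral_continuous: "0 \<le> a \<Longrightarrow> b \<le> R \<Longrightarrow> continuous_on {a..b} section_integral"
  using section_integral_lipschitz B_nonneg e_mem
  by (intro lipschitz_on_continuous_on[of "2 * R * B + 2 * B"] lipschitz_onI) (auto simp: dist_real_def)

text \<open>
  The ends of the inner interval at \<open>p k\<close> are the multiples \<open>i - k\<close> (truncated at \<open>0\<close>) and
  \<open>min (i + N - k) N\<close> of \<open>w\<close>, so the inner sum is a composite rule without boundary cells. The \<open>N\<close> rows
  of the inner rule, each with at most \<open>N\<close> cells of error \<open>E1\<close>, enter with weight \<open>w = R / N\<close>.
\<close>
lemma iterated_rule_error: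
  fixes N i :: nat and p :: "nat \<Rightarrow> real"
  assumes "i \<in> {1..N}" and R: "R = real N * w" and "0 < w"
    and p_mem: "\<And>k. k \<in> {1..N} \<Longrightarrow> p k \<in> {0..R}"
    and p_spacing: "\<And>k. e - p k = (real i - real k) * w"
    and inner: "\<And>k l. k \<in> {1..N} \<Longrightarrow> l \<in> {1..N} \<Longrightarrow>
      \<bar>integral {real (l - 1) * w..real l * w} (G (p k)) - w * G (p k) (p l)\<bar> \<le> E1"
    and outer: "\<And>k. k \<in> {1..N} \<Longrightarrow>
      \<bar>integral {real (k - 1) * w..real k * w} section_integral - w * section_integral (p k)\<bar> \<le> E2"
  shows "\<bar>integral {0..R} section_integral
           - w\<^sup>2 * (\<Sum>k\<in>{0<..N}. \<Sum>l\<in>{i - k<..min (i + N - k) N}. G (p k) (p l))\<bar>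
         \<le> real N * E2 + real N * R * E1"
proof -
  have "0 \<le> E1" using order_trans[OF abs_ge_zero inner[OF assms(1,1)]] .
  have row: "\<bar>section_integral (p k) - w * (\<Sum>l\<in>{i - k<..min (i + N - k) N}. G (p k) (p l))\<bar> \<le> real N * E1"
    if k: "k \<in> {1..N}" for k
  proof -
    let ?b = "min (i + N - k) N"
    have "i - k \<le> ?b" "?b \<le> N" using k assms(1) by auto
    have lower: "max (e - p k) 0 = real (i - k) * w"
    proof (cases "k \<le> i")
      case True
      then have "0 \<le> (real i - real k) * w" using \<open>0 < w\<close> by simp
      then show ?thesis unfolding p_spacing using True by (simp add: of_nat_diff)
    next
      case False
      then have "(real i - real k) * w \<le> 0" using \<open>0 < w\<close> by (simp add: mult_nonpos_nonneg)
      then show ?thesis unfolding p_spacing using False by simp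
    qed
    have upper: "min (e - p k + R) R = real ?b * w"
    proof -
      have "e - p k + R = real (i + N - k) * w"
        unfolding p_spacing R using k by (simp add: of_nat_diff algebra_simps)
      then show ?thesis
        unfolding R of_nat_min using \<open>0 < w\<close> by (simp add: min_mult_distrib_right)
    qed
    have "real ?b * w \<le> R" unfolding R using \<open>?b \<le> N\<close> \<open>0 < w\<close> by (intro mult_right_mono) auto
    then have "\<bar>integral {real (i - k) * w..real ?b * w} (G (p k)) - w * (\<Sum>l\<in>{i - k<..?b}. G (p k) (p l))\<bar>
        \<le> real (?b - (i - k)) * E1"
      using \<open>0 < w\<close> \<open>i - k \<le> ?b\<close> k
      by (intro composite_rule_error kernel_continuous inner p_mem) auto
    also have "\<dots> \<le> real N * E1"
      using \<open>?b \<le> N\<close> \<open>0 \<le> E1\<close> by (intro mult_right_mono) auto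
    finally show ?thesis unfolding section_integral_def lower upper .
  qed
  have "\<bar>integral {real 0 * w..real N * w} section_integral - w * (\<Sum>k\<in>{0<..N}. section_integral (p k))\<bar>
      \<le> real (N - 0) * E2"
    using \<open>0 < w\<close> R by (intro composite_rule_error section_integral_continuous outer) auto
  then have 1: "\<bar>integral {0..R} section_integral - w * (\<Sum>k\<in>{0<..N}. section_integral (p k))\<bar> \<le> real N * E2"
    by (simp add: R)
  let ?row = "\<lambda>k. \<Sum>l\<in>{i - k<..min (i + N - k) N}. G (p k) (p l)"
  have "\<bar>\<Sum>k\<in>{0<..N}. section_integral (p k) - w * ?row k\<bar> \<le> (\<Sum>k\<in>{0<..N}. real N * E1)"
    using row by (intro order_trans[OF sum_abs] sum_mono) auto
  then have "w * \<bar>\<Sum>k\<in>{0<..N}. section_integral (p k) - w * ?row k\<bar> \<le> w * (real N * (real N * E1))"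
    using \<open>0 < w\<close> by (intro mult_left_mono) auto
  moreover have "\<bar>w * (\<Sum>k\<in>{0<..N}. section_integral (p k)) - w\<^sup>2 * (\<Sum>k\<in>{0<..N}. ?row k)\<bar>
      = w * \<bar>\<Sum>k\<in>{0<..N}. section_integral (p k) - w * ?row k\<bar>"
  proof -
    have "w * (\<Sum>k\<in>{0<..N}. section_integral (p k)) - w\<^sup>2 * (\<Sum>k\<in>{0<..N}. ?row k)
        = w * (\<Sum>k\<in>{0<..N}. section_integral (p k) - w * ?row k)"
      by (simp add: sum_subtractf sum_distrib_left[symmetric] power2_eq_square algebra_simps)
    then show ?thesis using \<open>0 < w\<close> by (simp add: abs_mult)
  qed
  moreover have "w * (real N * (real N * E1)) = real N * R * E1" by (simp add: R mult_ac)
  ultimately show ?thesis using 1 by linarith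
qed

lemma rectangular_quadrature_error:
  assumes i: "i \<in> {1..N}" and R: "R = real N * w" "0 < w" and e: "e = (real i - 1) * w"
  defines "p \<equiv> \<lambda>k::nat. (real k - 1) * w"
  shows "\<bar>integral {0..R} section_integral
           - w\<^sup>2 * (\<Sum>k\<in>{0<..N}. \<Sum>l\<in>{i - k<..min (i + N - k) N}. G (p k) (p l))\<bar>
         \<le> R * (1 / 2) * w * (2 * R * B + 2 * B) + R\<^sup>2 * (1 / 2) * w * B"
proof -
  have cell: "{real (k - 1) * w..real k * w} = {p k..p k + w}"
    "0 \<le> p k" "p k \<in> {0..R}" "p k + w \<le> R"
    if "k \<in> {1..N}" for k
  proof -
    have "(real k - 1) * w \<le> real N * w" "real k * w \<le> real N * w"
      using that R(2) by (auto intro!: mult_right_mono)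
    then show "{real (k - 1) * w..real k * w} = {p k..p k + w}"
      "0 \<le> p k" "p k \<in> {0..R}" "p k + w \<le> R"
      using that R by (auto simp: p_def of_nat_diff algebra_simps)
  qed
  have "\<bar>integral {0..R} section_integral
           - w\<^sup>2 * (\<Sum>k\<in>{0<..N}. \<Sum>l\<in>{i - k<..min (i + N - k) N}. G (p k) (p l))\<bar>
         \<le> real N * (1 / 2 * w ^ 2 * (2 * R * B + 2 * B)) + real N * R * (1 / 2 * w ^ 2 * B)"
  proof (rule iterated_rule_error[OF i R])
    show "e - p k = (real i - real k) * w" for k by (simp add: e p_def algebra_simps)
    show "p k \<in> {0..R}" if "k \<in> {1..N}" for k using cell[OF that] by auto
    show "\<bar>integral {real (l - 1) * w..real l * w} (G (p k)) - w * G (p k) (p l)\<bar> \<le> 1 / 2 * w ^ 2 * B"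
      if "k \<in> {1..N}" "l \<in> {1..N}" for k l
      unfolding cell[OF that(2)]
    proof (rule left_endpoint_rule_error)
      show "\<bar>G (p k) y - G (p k) (p l)\<bar> \<le> B * (y - p l)" if "y \<in> {p l..p l + w}" for y
        using kernel_lipschitz[of "p k" "p k" y "p l"] cell[OF \<open>k \<in> {1..N}\<close>] cell[OF \<open>l \<in> {1..N}\<close>] that by auto
    qed (use R(2) cell[OF that(1)] cell[OF that(2)] in \<open>auto intro!: kernel_continuous\<close>)
    show "\<bar>integral {real (k - 1) * w..real k * w} section_integral - w * section_integral (p k)\<bar>
        \<le> 1 / 2 * w ^ 2 * (2 * R * B + 2 * B)" if "k \<in> {1..N}" for k
      unfolding cell[OF that]
    proof (rule left_endpoint_rule_error)
      show "\<bar>section_integral x - section_integral (p k)\<bar> \<le> (2 * R * B + 2 * B) * (x - p k)"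
        if "x \<in> {p k..p k + w}" for x
        using section_integral_lipschitz[of x "p k"] cell[OF \<open>k \<in> {1..N}\<close>] that by auto
    qed (use R(2) cell[OF that] in \<open>auto intro!: section_integral_continuous\<close>)
  qed
  also have "\<dots> = R * (1 / 2) * w * (2 * R * B + 2 * B) + R\<^sup>2 * (1 / 2) * w * B"
    unfolding R(1) by (simp add: power2_eq_square algebra_simps)
  finally show ?thesis .
qed

end

text \<open>
  The second difference is required to be small only if \<open>e\<close> is the centre \<open>c\<close> or not
  strictly between \<open>c - t\<close> and \<open>c + t\<close>. A midpoint rule on a grid that contains \<open>e\<close> among its nodes
  meets no other configuration, and in these two the kink of the kernel at \<open>x = e\<close> does no harm.
\<close>
locale smooth_collision_kernel = collision_kernel +
  fixes K :: real
  assumes K_nonneg: "0 \<le> K"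
    and kernel_second: "\<And>c t y. 0 \<le> t \<Longrightarrow> c - t \<in> {0..R} \<Longrightarrow> c + t \<in> {0..R} \<Longrightarrow> y \<in> {0..R} \<Longrightarrow>
      c + t \<le> e \<or> c = e \<or> e \<le> c - t \<Longrightarrow> \<bar>G (c + t) y + G (c - t) y - 2 * G c y\<bar> \<le> K * t\<^sup>2"
begin

lemma primitive_second_difference:
  assumes "0 \<le> t" "c - t \<in> {0..R}" "c + t \<in> {0..R}" "c + t \<le> e \<or> c = e \<or> e \<le> c - t" "z \<in> {0..R}"
  shows "\<bar>primitive (c + t) z + primitive (c - t) z - 2 * primitive c z\<bar> \<le> R * K * t\<^sup>2"
proof -
  have c: "c \<in> {0..R}" using assms by auto
  have "((\<lambda>y. G (c + t) y + G (c - t) y - 2 * G c y) has_integral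
      primitive (c + t) z + primitive (c - t) z - 2 * primitive c z) {0..z}"
    unfolding primitive_def using assms c
    by (intro has_integral_diff has_integral_add has_integral_mult_right kernel_integral) auto
  moreover have "norm (integral {0..z} (\<lambda>y. G (c + t) y + G (c - t) y - 2 * G c y)) \<le> (K * t\<^sup>2) * (z - 0)"
    using assms c by (intro integral_bound continuous_intros kernel_continuous)
      (auto intro!: kernel_second)
  ultimately have "\<bar>primitive (c + t) z + primitive (c - t) z - 2 * primitive c z\<bar> \<le> (K * t\<^sup>2) * z"
    by (simp add: has_integral_iff)
  also have "\<dots> \<le> (K * t\<^sup>2) * R" using assms K_nonneg by (intro mult_left_mono) auto
  finally show ?thesis by (simp add: mult_ac)
qed

text \<open>
  The end of the integration interval moves against \<open>x\<close>, as both slanted edges of the region demand.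
  The strips gained and lost in this way have width \<open>t\<close>, and on them \<open>G\<close> differs from the common
  corner value \<open>G c z\<close> by at most \<open>2 * B * t\<close>; hence their contributions cancel up to order \<open>t\<^sup>2\<close>.
\<close>
lemma primitive_slanted_second_difference:
  assumes "0 \<le> t" "c - t \<in> {0..R}" "c + t \<in> {0..R}" "c + t \<le> e \<or> c = e \<or> e \<le> c - t"
    and "0 \<le> z - t" "z + t \<le> R"
  shows "\<bar>primitive (c + t) (z - t) + primitive (c - t) (z + t) - 2 * primitive c z\<bar> \<le> (R * K + 4 * B) * t\<^sup>2"
proof -
  have c: "c \<in> {0..R}" using assms by auto
  have near: "\<bar>G x y - G c z\<bar> \<le> 2 * B * t"
    if "x \<in> {0..R}" "y \<in> {0..R}" "\<bar>x - c\<bar> \<le> t" "\<bar>y - z\<bar> \<le> t" for x y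
  proof -
    have "\<bar>G x y - G c z\<bar> \<le> B * (\<bar>x - c\<bar> + \<bar>y - z\<bar>)"
      using that c assms by (intro kernel_lipschitz) auto
    also have "\<dots> \<le> B * (2 * t)" using that B_nonneg by (intro mult_left_mono) auto
    finally show ?thesis by simp
  qed
  have "\<bar>primitive (c + t) z - primitive (c + t) (z - t) - (z - (z - t)) * G c z\<bar> \<le> 2 * B * t * (z - (z - t))"
    using assms by (intro primitive_increment near) auto
  moreover have "\<bar>primitive (c - t) (z + t) - primitive (c - t) z - (z + t - z) * G c z\<bar> \<le> 2 * B * t * (z + t - z)"
    using assms by (intro primitive_increment near) auto
  moreover have "\<bar>primitive (c + t) z + primitive (c - t) z - 2 * primitive c z\<bar> \<le> R * K * t\<^sup>2"
    using assms by (intro primitive_second_difference) auto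
  moreover have "2 * B * t * t = 2 * B * t\<^sup>2" by (simp add: power2_eq_square)
  ultimately show ?thesis unfolding distrib_right by simp
qed

text \<open>
  To the left of \<open>e\<close> only the lower end of the inner interval moves, to the right only the upper one.
  At \<open>c = e\<close> these two motions do not match, but the integrand there is of order \<open>t\<close> because \<open>G\<close>
  vanishes at \<open>x = e\<close>, so a strip of width \<open>t\<close> contributes only \<open>B * t\<^sup>2\<close>.
\<close>
lemma section_integral_second_difference:
  assumes t: "0 \<le> t" "c - t \<in> {0..R}" "c + t \<in> {0..R}" and kink: "c + t \<le> e \<or> c = e \<or> e \<le> c - t"
  shows "\<bar>section_integral (c + t) + section_integral (c - t) - 2 * section_integral c\<bar>
    \<le> (2 * R * K + 4 * B) * t\<^sup>2"
proof -
  have c: "c \<in> {0..R}" using t by auto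
  have R: "0 \<le> R * K" "0 \<le> B * t\<^sup>2" using e_mem K_nonneg B_nonneg by auto
  have weaken: "u \<le> (2 * R * K + 4 * B) * t\<^sup>2" if "u \<le> v + v'" "v \<le> R * K * t\<^sup>2" "v' \<le> (R * K + 4 * B) * t\<^sup>2"
    for u v v' :: real
    using that unfolding distrib_right by linarith
  note eq = section_integral_eq[OF t(3)] section_integral_eq[OF t(2)] section_integral_eq[OF c]
  have full: "\<bar>primitive (c + t) R + primitive (c - t) R - 2 * primitive c R\<bar> \<le> R * K * t\<^sup>2"
    using t kink e_mem by (intro primitive_second_difference) auto
  consider "c + t \<le> e" | "e \<le> c - t" | "c = e" using kink by blast
  then show ?thesis
  proof cases
    case 1
    then have ivl: "max (e - (c + t)) 0 = e - c - t" "max (e - (c - t)) 0 = e - c + t" "max (e - c) 0 = e - c"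
      "min (e - (c + t) + R) R = R" "min (e - (c - t) + R) R = R" "min (e - c + R) R = R"
      using t by auto
    have "\<bar>primitive (c + t) (e - c - t) + primitive (c - t) (e - c + t) - 2 * primitive c (e - c)\<bar>
        \<le> (R * K + 4 * B) * t\<^sup>2"
      using t kink e_mem 1 by (intro primitive_slanted_second_difference) auto
    then show ?thesis unfolding eq ivl by (intro weaken[OF _ full]) auto
  next
    case 2
    then have ivl: "max (e - (c + t)) 0 = 0" "max (e - (c - t)) 0 = 0" "max (e - c) 0 = 0"
      "min (e - (c + t) + R) R = (e - c + R) - t" "min (e - (c - t) + R) R = (e - c + R) + t"
      "min (e - c + R) R = e - c + R"
      using t by auto
    have [simp]: "primitive x 0 = 0" for x by (simp add: primitive_def)
    have "\<bar>primitive (c + t) ((e - c + R) - t) + primitive (c - t) ((e - c + R) + t) - 2 * primitive c (e - c + R)\<bar>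
        \<le> (R * K + 4 * B) * t\<^sup>2"
      using t kink e_mem 2 by (intro primitive_slanted_second_difference) auto
    then show ?thesis unfolding eq ivl using R by (intro weaken[of _ 0]) auto
  next
    case 3
    \<comment> \<open>Passing \<open>e\<close> to the right loses the top strip, passing it to the left loses the bottom strip.\<close>
    then have ivl: "max (e - (c + t)) 0 = 0" "max (e - (c - t)) 0 = t" "max (e - c) 0 = 0"
      "min (e - (c + t) + R) R = R - t" "min (e - (c - t) + R) R = R" "min (e - c + R) R = R"
      using t by auto
    have small: "\<bar>G x y - 0\<bar> \<le> B * t" if "x = c + t \<or> x = c - t" "y \<in> {0..R}" for x y
      using kernel_close[of x e y] kernel_vanish[of y] that t 3 e_mem unfolding close_def by auto
    have "\<bar>primitive (c + t) R - primitive (c + t) (R - t) - (R - (R - t)) * 0\<bar> \<le> B * t * (R - (R - t))"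
      using t 3 e_mem by (intro primitive_increment small) auto
    moreover have "\<bar>primitive (c - t) t - primitive (c - t) 0 - (t - 0) * 0\<bar> \<le> B * t * (t - 0)"
      using t 3 e_mem by (intro primitive_increment small) auto
    moreover have "B * t * t = B * t\<^sup>2" by (simp add: power2_eq_square)
    moreover have "primitive c 0 = 0" "primitive (c - t) 0 = 0" "primitive (c + t) 0 = 0"
      by (auto simp: primitive_def)
    moreover have "0 \<le> R * K * t\<^sup>2" using R by simp
    ultimately show ?thesis unfolding eq ivl using full R unfolding distrib_right by simp
  qed
qed

text \<open>
  Since \<open>e\<close> is the midpoint of the \<open>i\<close>-th cell, it is never in the interior of another cell, which is
  the configuration that the second difference bounds allow. By symmetry of the kernel they apply to
  the inner variable as well.
\<close>
lemma midpoint_quadrature_error: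
  assumes i: "i \<in> {1..N}" and R: "R = real N * w" "0 < w" and e: "e = (real i - 1 / 2) * w"
  defines "p \<equiv> \<lambda>k::nat. (real k - 1 / 2) * w"
  shows "\<bar>integral {0..R} section_integral
           - w\<^sup>2 * (\<Sum>k\<in>{0<..N}. \<Sum>l\<in>{i - k<..min (i + N - k) N}. G (p k) (p l))\<bar>
         \<le> R * (1 / 24) * w\<^sup>2 * (2 * R * K + 4 * B) + R\<^sup>2 * (1 / 24) * w\<^sup>2 * K"
proof -
  have cell: "{real (k - 1) * w..real k * w} = {p k - w / 2..p k + w / 2}"
    "0 \<le> p k - w / 2" "p k \<in> {0..R}" "p k + w / 2 \<le> R"
    if "k \<in> {1..N}" for k
  proof -
    have "real k * w \<le> real N * w" "1 * w \<le> real k * w"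
      using that R(2) by (auto intro!: mult_right_mono)
    moreover have "real (k - 1) * w = p k - w / 2" "real k * w = p k + w / 2"
      using that by (auto simp: p_def of_nat_diff algebra_simps)
    ultimately show "{real (k - 1) * w..real k * w} = {p k - w / 2..p k + w / 2}"
      "0 \<le> p k - w / 2" "p k \<in> {0..R}" "p k + w / 2 \<le> R"
      using R by auto
  qed
  have kink: "p k + t \<le> e \<or> p k = e \<or> e \<le> p k - t" if "t \<in> {0..w / 2}" for k t
  proof -
    consider "real k + 1 \<le> real i" | "k = i" | "real i + 1 \<le> real k" by linarith
    then show ?thesis
    proof cases
      case 1
      then have "(real k + 1) * w \<le> real i * w" using R(2) by (intro mult_right_mono) auto
      then show ?thesis using that R(2) by (simp add: e p_def algebra_simps)
    next
      case 3
      then have "(real i + 1) * w \<le> real k * w" using R(2) by (intro mult_right_mono) auto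
      then show ?thesis using that R(2) by (simp add: e p_def algebra_simps)
    qed (simp add: e p_def)
  qed
  have "\<bar>integral {0..R} section_integral
           - w\<^sup>2 * (\<Sum>k\<in>{0<..N}. \<Sum>l\<in>{i - k<..min (i + N - k) N}. G (p k) (p l))\<bar>
         \<le> real N * (1 / 24 * w ^ 3 * (2 * R * K + 4 * B)) + real N * R * (1 / 24 * w ^ 3 * K)"
  proof (rule iterated_rule_error[OF i R])
    show "e - p k = (real i - real k) * w" for k by (simp add: e p_def algebra_simps)
    show "p k \<in> {0..R}" if "k \<in> {1..N}" for k using cell[OF that] by auto
    show "\<bar>integral {real (l - 1) * w..real l * w} (G (p k)) - w * G (p k) (p l)\<bar> \<le> 1 / 24 * w ^ 3 * K"
      if kl: "k \<in> {1..N}" "l \<in> {1..N}" for k l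
      unfolding cell[OF that(2)]
    proof (rule midpoint_rule_error)
      show "\<bar>G (p k) (p l + t) + G (p k) (p l - t) - 2 * G (p k) (p l)\<bar> \<le> K * t\<^sup>2" if "t \<in> {0..w / 2}" for t
        using kernel_second[of t "p l" "p k"] kink[OF that, of l] cell[OF kl(1)] cell[OF kl(2)] that
          kernel_sym[of "p k" "p l + t"] kernel_sym[of "p k" "p l - t"] kernel_sym[of "p k" "p l"] by auto
    qed (use R(2) cell[OF that(1)] cell[OF that(2)] in \<open>auto intro!: kernel_continuous\<close>)
    show "\<bar>integral {real (k - 1) * w..real k * w} section_integral - w * section_integral (p k)\<bar>
        \<le> 1 / 24 * w ^ 3 * (2 * R * K + 4 * B)" if k: "k \<in> {1..N}" for k
      unfolding cell[OF that]
    proof (rule midpoint_rule_error)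
      show "\<bar>section_integral (p k + t) + section_integral (p k - t) - 2 * section_integral (p k)\<bar>
          \<le> (2 * R * K + 4 * B) * t\<^sup>2" if "t \<in> {0..w / 2}" for t
        using kink[OF that, of k] cell[OF k] that by (intro section_integral_second_difference) auto
    qed (use R(2) cell[OF that] in \<open>auto intro!: section_integral_continuous\<close>)
  qed
  also have "\<dots> = R * (1 / 24) * w\<^sup>2 * (2 * R * K + 4 * B) + R\<^sup>2 * (1 / 24) * w\<^sup>2 * K"
    unfolding R(1) by (simp add: power2_eq_square power3_eq_cube algebra_simps)
  finally show ?thesis .
qed

end

section \<open>The boson kernel\<close>

definition gain_minus_loss :: "(real \<Rightarrow> real) \<Rightarrow> real \<Rightarrow> real \<Rightarrow> real \<Rightarrow> real" where
  "gain_minus_loss g e x y =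
     g x * g y * (1 + g e) * (1 + g (x + y - e)) - g e * g (x + y - e) * (1 + g x) * (1 + g y)"

text \<open>
  The arguments \<open>x\<close> and \<open>y\<close> are the energies after the collision, and the fourth energy
  is \<open>x + y - e\<close>.
\<close>
definition boson_kernel :: "(real \<Rightarrow> real) \<Rightarrow> (real \<Rightarrow> real) \<Rightarrow> real \<Rightarrow> real \<Rightarrow> real \<Rightarrow> real" where
  "boson_kernel r g e x y = r (min x e + min y e - e) * gain_minus_loss g e x y"

text \<open>
  As \<open>e + \<epsilon>\<^sub>* = x + y\<close>, the pair of larger spread contains the smallest and the largest energy. Each
  of the four quadrants cut out by \<open>x = e\<close> and \<open>y = e\<close> has its own minimal energy, and the formula
  on the right reproduces all four.
\<close>
lemma Min_energies: "Min {e, x + y - e, x, y} = min x e + min y e - e" for e x y :: real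
  by (cases "x \<le> e"; cases "y \<le> e") (simp_all add: min_def)

lemma boson_integrand_eq_kernel:
  assumes "\<And>z. z \<in> {0..R} \<Longrightarrow> g z = f z" "\<And>z. z \<in> {0..R} \<Longrightarrow> r z = \<rho> z"
    and "e \<in> {0..R}" "x \<in> {0..R}" "y \<in> {0..R}" "x + y - e \<in> {0..R}"
  shows "boson_integrand \<rho> f e (x + y - e) x y = boson_kernel r g e x y"
proof -
  have "min x e + min y e - e \<in> {0..R}"
    using assms(3-6) by (cases "x \<le> e"; cases "y \<le> e") auto
  then show ?thesis
    unfolding boson_integrand_def boson_kernel_def gain_minus_loss_def Min_energies using assms by simp
qed

lemma boson_kernel_sym: "boson_kernel r g e x y = boson_kernel r g e y x"
  unfolding boson_kernel_def gain_minus_loss_def by (simp add: mult_ac add_ac)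

lemma gain_minus_loss_vanish: "gain_minus_loss g e e y = 0"
  unfolding gain_minus_loss_def by simp

text \<open>
  The constant must not depend on \<open>e\<close> or \<open>y\<close>. It is read off from the shape of the kernel, by applying
  the closure lemmas for sums and products along the expression.
\<close>
lemma boson_kernel_close:
  assumes g: "\<And>x y. x \<in> {-R..2 * R} \<Longrightarrow> y \<in> {-R..2 * R} \<Longrightarrow> close A \<bar>x - y\<bar> (g x) (g y)"
    and r: "\<And>x y. x \<in> {-R..2 * R} \<Longrightarrow> y \<in> {-R..2 * R} \<Longrightarrow> close D \<bar>x - y\<bar> (r x) (r y)"
  obtains B where "\<And>e x x' y. e \<in> {0..R} \<Longrightarrow> x \<in> {0..R} \<Longrightarrow> x' \<in> {0..R} \<Longrightarrow> y \<in> {0..R} \<Longrightarrow>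
    close B \<bar>x - x'\<bar> (boson_kernel r g e x y) (boson_kernel r g e x' y)"
proof -
  have "\<exists>B. \<forall>e x x' y. e \<in> {0..R} \<longrightarrow> x \<in> {0..R} \<longrightarrow> x' \<in> {0..R} \<longrightarrow> y \<in> {0..R} \<longrightarrow>
    close B \<bar>x - x'\<bar> (boson_kernel r g e x y) (boson_kernel r g e x' y)"
    unfolding boson_kernel_def gain_minus_loss_def
  proof (rule exI, intro allI impI)
    fix e x x' y assume m: "e \<in> {0..R}" "x \<in> {0..R}" "x' \<in> {0..R}" "y \<in> {0..R}"
    have const: "close A \<bar>x - x'\<bar> (g z) (g z)" if "z \<in> {0..R}" for z
      using that by (intro close_mono[OF g]) auto
    have one: "close 1 \<bar>x - x'\<bar> 1 1" by (intro close_const) auto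
    have x: "close A \<bar>x - x'\<bar> (g x) (g x')" "close A \<bar>x - x'\<bar> (g (x + y - e)) (g (x' + y - e))"
      using m by (intro close_mono[OF g]; simp)+
    have r': "close D \<bar>x - x'\<bar> (r (min x e + min y e - e)) (r (min x' e + min y e - e))"
      using m by (intro close_mono[OF r]) auto
    show "close (2 * D * (2 * (2 * (2 * A * A) * (1 + A)) * (1 + A) + 2 * (2 * (2 * A * A) * (1 + A)) * (1 + A))) \<bar>x - x'\<bar>
       (r (min x e + min y e - e) *
         (g x * g y * (1 + g e) * (1 + g (x + y - e)) - g e * g (x + y - e) * (1 + g x) * (1 + g y)))
       (r (min x' e + min y e - e) *
         (g x' * g y * (1 + g e) * (1 + g (x' + y - e)) - g e * g (x' + y - e) * (1 + g x') * (1 + g y)))"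
      by (intro close_mult close_diff close_add const one x r' m)
  qed
  then show ?thesis using that by blast
qed

lemma gain_minus_loss_second_close:
  assumes g: "\<And>x y. x \<in> {-R..2 * R} \<Longrightarrow> y \<in> {-R..2 * R} \<Longrightarrow> close A \<bar>x - y\<bar> (g x) (g y)"
    and g2: "\<And>c t. 0 \<le> t \<Longrightarrow> c - t \<in> {-R..2 * R} \<Longrightarrow> c + t \<in> {-R..2 * R} \<Longrightarrow>
           second_close A t (g (c + t)) (g c) (g (c - t))"
  obtains M where "\<And>e c t y. e \<in> {0..R} \<Longrightarrow> 0 \<le> t \<Longrightarrow> c - t \<in> {0..R} \<Longrightarrow> c + t \<in> {0..R} \<Longrightarrow> y \<in> {0..R} \<Longrightarrow>
    second_close M t (gain_minus_loss g e (c + t) y) (gain_minus_loss g e c y) (gain_minus_loss g e (c - t) y)"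
proof -
  have "\<exists>M. \<forall>e c t y. e \<in> {0..R} \<longrightarrow> 0 \<le> t \<longrightarrow> c - t \<in> {0..R} \<longrightarrow> c + t \<in> {0..R} \<longrightarrow> y \<in> {0..R} \<longrightarrow>
    second_close M t (gain_minus_loss g e (c + t) y) (gain_minus_loss g e c y) (gain_minus_loss g e (c - t) y)"
    unfolding gain_minus_loss_def
  proof (rule exI, intro allI impI)
    fix e c t y assume m: "e \<in> {0..R}" "0 \<le> t" "c - t \<in> {0..R}" "c + t \<in> {0..R}" "y \<in> {0..R}"
    have const: "second_close A t (g z) (g z) (g z)" if "z \<in> {0..R}" for z
    proof (rule second_close_const[OF m(2)])
      show "\<bar>g z\<bar> \<le> A" using g[of z z] that unfolding close_def by simp
    qed
    have one: "second_close 1 t 1 1 1" using m(2) by (intro second_close_const) auto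
    have x: "second_close A t (g (c + t)) (g c) (g (c - t))"
      using m by (intro g2; simp)
    have "second_close A t (g (c + y - e + t)) (g (c + y - e)) (g (c + y - e - t))"
      using m by (intro g2; simp)
    moreover have "c + t + y - e = c + y - e + t" "c - t + y - e = c + y - e - t" by simp_all
    ultimately have s: "second_close A t (g (c + t + y - e)) (g (c + y - e)) (g (c - t + y - e))"
      by (simp only:)
    show "second_close (4 * (4 * (4 * A * A) * (1 + A)) * (1 + A) + 4 * (4 * (4 * A * A) * (1 + A)) * (1 + A)) t
       (g (c + t) * g y * (1 + g e) * (1 + g (c + t + y - e)) - g e * g (c + t + y - e) * (1 + g (c + t)) * (1 + g y))
       (g c * g y * (1 + g e) * (1 + g (c + y - e)) - g e * g (c + y - e) * (1 + g c) * (1 + g y))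
       (g (c - t) * g y * (1 + g e) * (1 + g (c - t + y - e)) - g e * g (c - t + y - e) * (1 + g (c - t)) * (1 + g y))"
      by (intro second_close_mult second_close_diff second_close_add const one x s m)
  qed
  then show ?thesis using that by blast
qed

text \<open>
  Left of \<open>e\<close> the argument of \<open>r\<close> is a translate of \<open>x\<close>, right of \<open>e\<close> it is constant, and both cases are
  covered by the product bound. At \<open>c = e\<close> the factor \<open>r\<close> is merely Lipschitz, and the vanishing of
  gain minus loss compensates.
\<close>
lemma boson_kernel_second_difference:
  assumes g: "\<And>x y. x \<in> {-R..2 * R} \<Longrightarrow> y \<in> {-R..2 * R} \<Longrightarrow> close A \<bar>x - y\<bar> (g x) (g y)"
    and g2: "\<And>c t. 0 \<le> t \<Longrightarrow> c - t \<in> {-R..2 * R} \<Longrightarrow> c + t \<in> {-R..2 * R} \<Longrightarrow>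
           second_close A t (g (c + t)) (g c) (g (c - t))"
    and r: "\<And>x y. x \<in> {-R..2 * R} \<Longrightarrow> y \<in> {-R..2 * R} \<Longrightarrow> close D \<bar>x - y\<bar> (r x) (r y)"
    and r2: "\<And>c t. 0 \<le> t \<Longrightarrow> c - t \<in> {-R..2 * R} \<Longrightarrow> c + t \<in> {-R..2 * R} \<Longrightarrow>
           second_close D t (r (c + t)) (r c) (r (c - t))"
  obtains K where "0 \<le> K"
    and "\<And>e c t y. e \<in> {0..R} \<Longrightarrow> 0 \<le> t \<Longrightarrow> c - t \<in> {0..R} \<Longrightarrow> c + t \<in> {0..R} \<Longrightarrow> y \<in> {0..R} \<Longrightarrow>
      c + t \<le> e \<or> c = e \<or> e \<le> c - t \<Longrightarrow>
      \<bar>boson_kernel r g e (c + t) y + boson_kernel r g e (c - t) y - 2 * boson_kernel r g e c y\<bar> \<le> K * t\<^sup>2"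
proof -
  obtain M where M: "\<And>e c t y. e \<in> {0..R} \<Longrightarrow> 0 \<le> t \<Longrightarrow> c - t \<in> {0..R} \<Longrightarrow> c + t \<in> {0..R} \<Longrightarrow> y \<in> {0..R} \<Longrightarrow>
    second_close M t (gain_minus_loss g e (c + t) y) (gain_minus_loss g e c y) (gain_minus_loss g e (c - t) y)"
    using gain_minus_loss_second_close[OF g g2] by blast
  have "\<bar>boson_kernel r g e (c + t) y + boson_kernel r g e (c - t) y - 2 * boson_kernel r g e c y\<bar>
      \<le> \<bar>4 * D * M\<bar> * t\<^sup>2"
    if m: "e \<in> {0..R}" "0 \<le> t" "c - t \<in> {0..R}" "c + t \<in> {0..R}" "y \<in> {0..R}"
      and kink: "c + t \<le> e \<or> c = e \<or> e \<le> c - t" for e c t y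
  proof -
    note F = M[OF m]
    have product: ?thesis
      if "second_close D t (r (min (c + t) e + min y e - e)) (r (min c e + min y e - e))
            (r (min (c - t) e + min y e - e))"
    proof -
      have "4 * D * M * t\<^sup>2 \<le> \<bar>4 * D * M\<bar> * t\<^sup>2" by (intro mult_right_mono) auto
      then show ?thesis
        using second_close_mult[OF that F] unfolding second_close_def boson_kernel_def by linarith
    qed
    consider "c + t \<le> e" | "e \<le> c - t" | "c = e" using kink by blast
    then show ?thesis
    proof cases
      case 1
      then have "min (c + t) e + min y e - e = (c + (min y e - e)) + t" "min c e + min y e - e = c + (min y e - e)"
        "min (c - t) e + min y e - e = (c + (min y e - e)) - t"
        using m by auto
      moreover have "second_close D t (r ((c + (min y e - e)) + t)) (r (c + (min y e - e))) (r ((c + (min y e - e)) - t))"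
        using m by (intro r2) auto
      ultimately show ?thesis by (intro product) (simp only:)
    next
      case 2
      then have "min (c + t) e = e" "min c e = e" "min (c - t) e = e" using m by auto
      moreover have "\<bar>r (min y e)\<bar> \<le> D" using r[of "min y e" "min y e"] m unfolding close_def by auto
      ultimately show ?thesis using m(2) by (intro product) (simp add: second_close_const)
    next
      case 3
      have "close D t (r (min (c + t) e + min y e - e)) (r (min c e + min y e - e))"
        "close D t (r (min (c - t) e + min y e - e)) (r (min c e + min y e - e))"
        using m 3 by (intro close_mono[OF r]; auto)+
      then have "\<bar>boson_kernel r g e (c + t) y + boson_kernel r g e (c - t) y\<bar> \<le> 3 * D * M * t\<^sup>2"
        using F second_close_mult_vanishing unfolding boson_kernel_def 3 gain_minus_loss_vanish by blast
      also have "\<dots> \<le> \<bar>4 * D * M\<bar> * t\<^sup>2" by (intro mult_right_mono) auto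
      finally show ?thesis using 3 by (simp add: boson_kernel_def gain_minus_loss_vanish)
    qed
  qed
  then show ?thesis using that[of "\<bar>4 * D * M\<bar>"] by simp
qed

text \<open>
  The sum is reindexed from \<open>(j, l)\<close> to \<open>(k, l)\<close> with \<open>k = i + j - l\<close>, the discrete counterpart of
  expressing \<open>\<epsilon>\<^sub>*\<close> by the other energies.
\<close>
lemma Q_quad_iterated:
  assumes "i \<in> {1..N}"
  shows "Q_quad R N p \<rho> f i = (R / real N)\<^sup>2 *
    (\<Sum>k\<in>{0<..N}. \<Sum>l\<in>{i - k<..min (i + N - k) N}. boson_integrand \<rho> f (p i) (p (k + l - i)) (p k) (p l))"
proof -
  have "(\<Sum>(j, l)\<in>{(j, l). j \<in> {1..N} \<and> l \<in> {1..N} \<and> 1 \<le> i + j - l \<and> i + j - l \<le> N}.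
          boson_integrand \<rho> f (p i) (p j) (p (i + j - l)) (p l))
      = (\<Sum>(k, l)\<in>Sigma {0<..N} (\<lambda>k. {i - k<..min (i + N - k) N}).
          boson_integrand \<rho> f (p i) (p (k + l - i)) (p k) (p l))"
    using assms
    by (intro sum.reindex_bij_witness[of _ "\<lambda>(k, l). (k + l - i, l)" "\<lambda>(j, l). (i + j - l, l)"])
       auto
  then show ?thesis unfolding Q_quad_def by (simp add: sum.Sigma)
qed

section \<open>Error of the collision quadrature\<close>

lemma Q_trunc_eq_section_integrals:
  assumes "\<And>z. z \<in> {0..R} \<Longrightarrow> g z = f z" "\<And>z. z \<in> {0..R} \<Longrightarrow> r z = \<rho> z" "e \<in> {0..R}"
  shows "Q_trunc R \<rho> f e =
    integral {0..R} (\<lambda>x. integral {max (e - x) 0..min (e - x + R) R} (boson_kernel r g e x))"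
  unfolding Q_trunc_def using assms(3)
  by (intro Henstock_Kurzweil_Integration.integral_cong boson_integrand_eq_kernel[OF assms]) auto

lemma grid_mem:
  assumes "0 < R" "k \<in> {1..N}"
  shows "grid m R N k \<in> {0..R}"
proof -
  define w where "w = R / real N"
  have w: "0 < w" "real N * w = R" using assms by (auto simp: w_def)
  have "real k * w \<le> R" "1 * w \<le> real k * w"
    unfolding w(2)[symmetric] using assms w(1) by (intro mult_right_mono; simp)+
  moreover have "grid m R N k = real k * w - w \<or> grid m R N k = real k * w - w / 2"
    unfolding grid_def w_def[symmetric] left_diff_distrib by auto
  ultimately show ?thesis using w(1) by auto
qed

text \<open>
  Both grids are closed under the energy balance: the common offset of the nodes, \<open>1\<close> or \<open>1/2\<close> mesh widths,
  is added twice and subtracted once.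
\<close>
lemma grid_add_diff:
  assumes "i \<le> k + l"
  shows "grid m R N k + grid m R N l - grid m R N i = grid m R N (k + l - i)"
  using assms by (simp add: grid_def of_nat_diff left_diff_distrib distrib_right diff_divide_distrib add_divide_distrib)

lemma Q_quad_eq_kernel_sum:
  assumes "\<And>z. z \<in> {0..R} \<Longrightarrow> g z = f z" "\<And>z. z \<in> {0..R} \<Longrightarrow> r z = \<rho> z" "0 < R" "i \<in> {1..N}"
    and p_def: "p = grid m R N"
  shows "Q_quad R N p \<rho> f i = (R / real N)\<^sup>2 *
    (\<Sum>k\<in>{0<..N}. \<Sum>l\<in>{i - k<..min (i + N - k) N}. boson_kernel r g (p i) (p k) (p l))"
proof -
  have "boson_integrand \<rho> f (p i) (p (k + l - i)) (p k) (p l) = boson_kernel r g (p i) (p k) (p l)"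
    if "k \<in> {0<..N}" "l \<in> {i - k<..min (i + N - k) N}" for k l
  proof -
    have "k + l - i \<in> {1..N}" "i \<le> k + l" "k \<in> {1..N}" "l \<in> {1..N}" using that by auto
    then show ?thesis
      using boson_integrand_eq_kernel[OF assms(1,2) grid_mem[OF assms(3,4), of m] grid_mem[OF assms(3), of k N m]
          grid_mem[OF assms(3), of l N m]] grid_mem[OF assms(3), of "k + l - i" N m]
      unfolding p_def by (simp add: grid_add_diff)
  qed
  then have "(\<Sum>k\<in>{0<..N}. \<Sum>l\<in>{i - k<..min (i + N - k) N}.
        boson_integrand \<rho> f (p i) (p (k + l - i)) (p k) (p l))
      = (\<Sum>k\<in>{0<..N}. \<Sum>l\<in>{i - k<..min (i + N - k) N}. boson_kernel r g (p i) (p k) (p l))"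
    by (intro sum.cong refl)
  then show ?thesis unfolding Q_quad_iterated[OF assms(4)] by (rule arg_cong)
qed

theorem theorem2p1:
  fixes R :: real and m :: nat and f \<rho> :: "real \<Rightarrow> real"
  assumes "R > 0"
    and "m \<in> {1, 2}"
    and "\<And>x. x \<in> {0..R} \<Longrightarrow> f x \<ge> 0"
    and "\<And>x. x \<in> {0..R} \<Longrightarrow> \<rho> x \<ge> 0"
    and "Ck_on m {0..R} f"
    and "Ck_on m {0..R} \<rho>"
  shows "\<exists>M :: real. \<forall>N \<ge> 1. \<forall>i \<in> {1..N}.
           \<bar>Q_trunc R \<rho> f (grid m R N i) - Q_quad R N (grid m R N) \<rho> f i\<bar>
             \<le> R\<^sup>2 * quad_const m * (R / real N) ^ m * M"
proof -
  have "1 \<le> m" using assms(2) by auto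
  obtain g A where g_eq: "\<And>x. x \<in> {0..R} \<Longrightarrow> g x = f x"
    and g: "\<And>x y. x \<in> {-R..2 * R} \<Longrightarrow> y \<in> {-R..2 * R} \<Longrightarrow> close A \<bar>x - y\<bar> (g x) (g y)"
    and g2: "\<And>c t. 2 \<le> m \<Longrightarrow> 0 \<le> t \<Longrightarrow> c - t \<in> {-R..2 * R} \<Longrightarrow> c + t \<in> {-R..2 * R} \<Longrightarrow>
           second_close A t (g (c + t)) (g c) (g (c - t))"
    using Ck_on_extension[OF assms(1) \<open>1 \<le> m\<close> assms(5)] by metis
  obtain r D where r_eq: "\<And>x. x \<in> {0..R} \<Longrightarrow> r x = \<rho> x"
    and r: "\<And>x y. x \<in> {-R..2 * R} \<Longrightarrow> y \<in> {-R..2 * R} \<Longrightarrow> close D \<bar>x - y\<bar> (r x) (r y)"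
    and r2: "\<And>c t. 2 \<le> m \<Longrightarrow> 0 \<le> t \<Longrightarrow> c - t \<in> {-R..2 * R} \<Longrightarrow> c + t \<in> {-R..2 * R} \<Longrightarrow>
           second_close D t (r (c + t)) (r c) (r (c - t))"
    using Ck_on_extension[OF assms(1) \<open>1 \<le> m\<close> assms(6)] by metis
  obtain B where B: "\<And>e x x' y. e \<in> {0..R} \<Longrightarrow> x \<in> {0..R} \<Longrightarrow> x' \<in> {0..R} \<Longrightarrow> y \<in> {0..R} \<Longrightarrow>
    close B \<bar>x - x'\<bar> (boson_kernel r g e x y) (boson_kernel r g e x' y)"
    using boson_kernel_close[OF g r] by blast
  have vanish: "boson_kernel r g e e y = 0" for e y
    by (simp add: boson_kernel_def gain_minus_loss_vanish)
  have kernel: "collision_kernel R e B (boson_kernel r g e)" if "e \<in> {0..R}" for e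
    by (intro collision_kernel.intro that boson_kernel_sym vanish B)
  have Q_eq: "Q_trunc R \<rho> f (grid m R N i) = integral {0..R} (\<lambda>x.
        integral {max (grid m R N i - x) 0..min (grid m R N i - x + R) R}
          (boson_kernel r g (grid m R N i) x))"
    "Q_quad R N (grid m R N) \<rho> f i = (R / real N)\<^sup>2 *
      (\<Sum>k\<in>{0<..N}. \<Sum>l\<in>{i - k<..min (i + N - k) N}.
        boson_kernel r g (grid m R N i) (grid m R N k) (grid m R N l))"
    if "i \<in> {1..N}" for i N
    using that g_eq r_eq assms(1)
    by (auto intro!: Q_trunc_eq_section_integrals Q_quad_eq_kernel_sum grid_mem simp del: atLeastAtMost_iff)
  \<comment> \<open>The outer rule contributes with a single factor \<open>R\<close>, so its constant is divided by \<open>R\<close>.\<close>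
  have regroup: "R * C * u * L + R\<^sup>2 * C * u * L' = R\<^sup>2 * C * u * (L / R + L')" for C u L L' :: real
    using assms(1) by (simp add: power2_eq_square distrib_left)
  consider "m = 1" | "m = 2" using assms(2) by auto
  then show ?thesis
  proof cases
    case 1
    show ?thesis
    proof (intro exI[of _ "(2 * R * B + 2 * B) / R + B"] allI impI ballI)
      fix N i :: nat assume N: "1 \<le> N" "i \<in> {1..N}"
      define e where "e = grid m R N i"
      interpret collision_kernel R e B "boson_kernel r g e"
        using kernel grid_mem[OF assms(1) N(2)] unfolding e_def by blast
      have "\<bar>Q_trunc R \<rho> f (grid m R N i) - Q_quad R N (grid m R N) \<rho> f i\<bar>
          \<le> R * (1 / 2) * (R / real N) * (2 * R * B + 2 * B) + R\<^sup>2 * (1 / 2) * (R / real N) * B"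
        using rectangular_quadrature_error[OF N(2), of "R / real N"] N assms(1)
        unfolding Q_eq[OF N(2)] section_integral_def
        by (simp add: e_def grid_def 1)
      also have "\<dots> = R\<^sup>2 * quad_const m * (R / real N) ^ m * ((2 * R * B + 2 * B) / R + B)"
        unfolding regroup by (simp add: 1 quad_const_def)
      finally show "\<bar>Q_trunc R \<rho> f (grid m R N i) - Q_quad R N (grid m R N) \<rho> f i\<bar>
          \<le> R\<^sup>2 * quad_const m * (R / real N) ^ m * ((2 * R * B + 2 * B) / R + B)" .
    qed
  next
    case 2
    then have "2 \<le> m" by simp
    obtain K where K: "0 \<le> K" "\<And>e c t y. e \<in> {0..R} \<Longrightarrow> 0 \<le> t \<Longrightarrow> c - t \<in> {0..R} \<Longrightarrow> c + t \<in> {0..R} \<Longrightarrow> y \<in> {0..R} \<Longrightarrow>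
      c + t \<le> e \<or> c = e \<or> e \<le> c - t \<Longrightarrow>
      \<bar>boson_kernel r g e (c + t) y + boson_kernel r g e (c - t) y - 2 * boson_kernel r g e c y\<bar> \<le> K * t\<^sup>2"
      using boson_kernel_second_difference[OF g g2[OF \<open>2 \<le> m\<close>] r r2[OF \<open>2 \<le> m\<close>]] by blast
    show ?thesis
    proof (intro exI[of _ "(2 * R * K + 4 * B) / R + K"] allI impI ballI)
      fix N i :: nat assume N: "1 \<le> N" "i \<in> {1..N}"
      define e where "e = grid m R N i"
      have e: "e \<in> {0..R}" unfolding e_def by (rule grid_mem[OF assms(1) N(2)])
      interpret smooth_collision_kernel R e B "boson_kernel r g e" K
        using kernel[OF e] K e by (intro smooth_collision_kernel.intro smooth_collision_kernel_axioms.intro) auto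
      have "\<bar>Q_trunc R \<rho> f (grid m R N i) - Q_quad R N (grid m R N) \<rho> f i\<bar>
          \<le> R * (1 / 24) * (R / real N)\<^sup>2 * (2 * R * K + 4 * B) + R\<^sup>2 * (1 / 24) * (R / real N)\<^sup>2 * K"
        using midpoint_quadrature_error[OF N(2), of "R / real N"] N assms(1)
        unfolding Q_eq[OF N(2)] section_integral_def
        by (simp add: e_def grid_def 2)
      also have "\<dots> = R\<^sup>2 * quad_const m * (R / real N) ^ m * ((2 * R * K + 4 * B) / R + K)"
        unfolding regroup by (simp add: 2 quad_const_def)
      finally show "\<bar>Q_trunc R \<rho> f (grid m R N i) - Q_quad R N (grid m R N) \<rho> f i\<bar>
          \<le> R\<^sup>2 * quad_const m * (R / real N) ^ m * ((2 * R * K + 4 * B) / R + K)" .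
    qed
  qed
qed

end
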